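(* Let $\lambda\neq 0$ and let $X$ be the vector field associated with the real analytic system $\dot x=y+P(x,y,z)$, $\dot y=Q(x,y,z)$, $\dot z=-\lambda z+R(x,y,z)$, with $j^1P(0)=j^1Q(0)=j^1R(0)=0$. Let $H(x,y,z)=y^2+\sum_{k\geqslant 3}H_k(x,y,z)$ ($H_k$ a homogeneous polynomial of degree $k$) be a formal series such that $XH=\sum_{k\geqslant 4}\omega_kx^k$ with $\omega_k\in\mathbb{R}$. If there exists $n\in\mathbb{N}$ such that $j^{2n}XH(0)=\omega_{2n}x^{2n}$ with $\omega_{2n}\neq 0$, then the origin cannot be a center on the center manifold.
   Context: $j^lG(0)$ denotes the Taylor polynomial of degree $l$ of $G$ at the origin. $XH=(y+P)\partial_xH+Q\,\partial_yH+(-\lambda z+R)\partial_zH$ as formal power series. A center manifold is an invariant surface $z=h(x,y)$ through the origin tangent to the $xy$-plane there, with $h$ of class $C^r$, where $r$ may be taken any finite integer as large as needed. The origin is a center on a center manifold if, for the planar system $\dot x=y+P(x,y,h(x,y))$, $\dot y=Q(x,y,h(x,y))$, some punctured neighborhood of the origin is filled with periodic orbits surrounding the origin. *)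

theory Defs
  imports "HOL-Analysis.Analysis" "HOL-Computational_Algebra.Formal_Power_Series"
begin

section \<open>Formal power series in three variables\<close>

text \<open>
  The ring of formal power series in x, y, z is represented as the iterated ring of series in x
  over series in y over series in z, so that all ring operations are those of the library.
\<close>

type_synonym fps3 = "real fps fps fps"

definition coeff3 :: "fps3 \<Rightarrow> nat \<Rightarrow> nat \<Rightarrow> nat \<Rightarrow> real" where
  "coeff3 F i j k = fps_nth (fps_nth (fps_nth F i) j) k"

definition const3 :: "real \<Rightarrow> fps3" where
  "const3 c = fps_const (fps_const (fps_const c))"

definition var_x :: fps3 where "var_x = fps_X"
definition var_y :: fps3 where "var_y = fps_const fps_X"
definition var_z :: fps3 where "var_z = fps_const (fps_const fps_X)"

definition deriv_x :: "fps3 \<Rightarrow> fps3" where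
  "deriv_x F = fps_deriv F"
definition deriv_y :: "fps3 \<Rightarrow> fps3" where
  "deriv_y F = Abs_fps (\<lambda>i. fps_deriv (fps_nth F i))"
definition deriv_z :: "fps3 \<Rightarrow> fps3" where
  "deriv_z F = Abs_fps (\<lambda>i. Abs_fps (\<lambda>j. fps_deriv (fps_nth (fps_nth F i) j)))"

definition jet :: "nat \<Rightarrow> fps3 \<Rightarrow> fps3" where
  "jet l F = Abs_fps (\<lambda>i. Abs_fps (\<lambda>j. Abs_fps (\<lambda>k.
     if i + j + k \<le> l then coeff3 F i j k else 0)))"

definition series_in_x :: "(nat \<Rightarrow> real) \<Rightarrow> fps3" where
  "series_in_x a = Abs_fps (\<lambda>k. fps_const (fps_const (a k)))"

text \<open>The formal derivative XH; the first three series are those of the nonlinear terms of X.\<close>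

definition lie_derivative :: "real \<Rightarrow> fps3 \<Rightarrow> fps3 \<Rightarrow> fps3 \<Rightarrow> fps3 \<Rightarrow> fps3" where
  "lie_derivative lam Pf Qf Rf H =
     (var_y + Pf) * deriv_x H + Qf * deriv_y H + (const3 (- lam) * var_z + Rf) * deriv_z H"


section \<open>Real analytic functions\<close>

text \<open>
  F is the power series of f at p. Since \<^const>\<open>has_sum\<close> is unconditional summation, no order of
  summation of the triple series has to be chosen.
\<close>

definition has_power_series_at ::
  "(real \<times> real \<times> real \<Rightarrow> real) \<Rightarrow> fps3 \<Rightarrow> real \<times> real \<times> real \<Rightarrow> bool" where
  "has_power_series_at f F p \<longleftrightarrow>
     (\<exists>\<rho>>0. \<forall>x y z. \<bar>x\<bar> < \<rho> \<and> \<bar>y\<bar> < \<rho> \<and> \<bar>z\<bar> < \<rho> \<longrightarrow>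
        ((\<lambda>(i, j, k). coeff3 F i j k * x ^ i * y ^ j * z ^ k) has_sum f (p + (x, y, z))) UNIV)"

definition real_analytic_on ::
  "(real \<times> real \<times> real \<Rightarrow> real) \<Rightarrow> (real \<times> real \<times> real) set \<Rightarrow> bool" where
  "real_analytic_on f U \<longleftrightarrow> (\<forall>p\<in>U. \<exists>F. has_power_series_at f F p)"


section \<open>Center manifolds and centers\<close>

definition vector_field ::
  "real \<Rightarrow> (real \<times> real \<times> real \<Rightarrow> real) \<Rightarrow> (real \<times> real \<times> real \<Rightarrow> real) \<Rightarrow>
   (real \<times> real \<times> real \<Rightarrow> real) \<Rightarrow> real \<times> real \<times> real \<Rightarrow> real \<times> real \<times> real" where
  "vector_field lam P Q R =
     (\<lambda>(x, y, z). (y + P (x, y, z), Q (x, y, z), - lam * z + R (x, y, z)))"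

text \<open>Functions of class C^r on an open subset of the plane; fx and fy are the partial derivatives.\<close>

primrec class_C :: "nat \<Rightarrow> (real \<times> real) set \<Rightarrow> (real \<times> real \<Rightarrow> real) \<Rightarrow> bool" where
  "class_C 0 D f \<longleftrightarrow> continuous_on D f"
| "class_C (Suc r) D f \<longleftrightarrow>
     (\<exists>fx fy. (\<forall>p\<in>D. (f has_derivative (\<lambda>(u, v). fx p * u + fy p * v)) (at p)) \<and>
        class_C r D fx \<and> class_C r D fy)"

definition graph_over :: "(real \<times> real) set \<Rightarrow> (real \<times> real \<Rightarrow> real) \<Rightarrow> (real \<times> real \<times> real) set" where
  "graph_over D h = {(x, y, h (x, y)) | x y. (x, y) \<in> D}"

text \<open>
  Invariance is local, as it must be for a surface that is only given near an equilibrium: the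
  solution through a point of the surface stays on the surface for small positive and negative time.
\<close>

definition locally_invariant ::
  "(real \<times> real \<times> real \<Rightarrow> real \<times> real \<times> real) \<Rightarrow> (real \<times> real \<times> real) set \<Rightarrow> bool" where
  "locally_invariant X S \<longleftrightarrow>
     (\<forall>p\<in>S. \<exists>\<epsilon>>0. \<exists>u. u 0 = p \<and>
        (\<forall>t\<in>{-\<epsilon><..<\<epsilon>}. u t \<in> S \<and> (u has_vector_derivative X (u t)) (at t)))"

definition center_manifold ::
  "nat \<Rightarrow> (real \<times> real \<times> real) set \<Rightarrow> (real \<times> real \<times> real \<Rightarrow> real \<times> real \<times> real) \<Rightarrow>
   (real \<times> real) set \<Rightarrow> (real \<times> real \<Rightarrow> real) \<Rightarrow> bool" where
  "center_manifold r U X D h \<longleftrightarrow>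
     open D \<and> (0, 0) \<in> D \<and> class_C r D h \<and> graph_over D h \<subseteq> U \<and>
     h (0, 0) = 0 \<and> (h has_derivative (\<lambda>_. 0)) (at (0, 0)) \<and>
     locally_invariant X (graph_over D h)"

definition reduced_field ::
  "(real \<times> real \<times> real \<Rightarrow> real) \<Rightarrow> (real \<times> real \<times> real \<Rightarrow> real) \<Rightarrow> (real \<times> real \<Rightarrow> real) \<Rightarrow>
   real \<times> real \<Rightarrow> real \<times> real" where
  "reduced_field P Q h = (\<lambda>(x, y). (y + P (x, y, h (x, y)), Q (x, y, h (x, y))))"

definition periodic_orbit ::
  "(real \<times> real) set \<Rightarrow> (real \<times> real \<Rightarrow> real \<times> real) \<Rightarrow> (real \<times> real) set \<Rightarrow> bool" where
  "periodic_orbit D Y C \<longleftrightarrow>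
     C \<subseteq> D \<and>
     (\<exists>\<gamma> T. T > 0 \<and> C = range \<gamma> \<and>
        (\<forall>t. (\<gamma> has_vector_derivative Y (\<gamma> t)) (at t) \<and> \<gamma> (t + T) = \<gamma> t))"

text \<open>
  The origin is a center of the planar field Y with domain D. An orbit C surrounds the origin if
  the origin lies in a bounded component of the complement of C, which also excludes that C is
  a single equilibrium.
\<close>

definition center_at_origin ::
  "(real \<times> real) set \<Rightarrow> (real \<times> real \<Rightarrow> real \<times> real) \<Rightarrow> bool" where
  "center_at_origin D Y \<longleftrightarrow>
     (\<exists>V. open V \<and> (0, 0) \<in> V \<and> V \<subseteq> D \<and>
        (\<forall>p \<in> V - {(0, 0)}. \<exists>C. periodic_orbit D Y C \<and> p \<in> C \<and> (0, 0) \<in> inside C))"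

end

theory Submission
  imports Defs "HOL-Library.Landau_Symbols"
begin

text \<open>
  Let \<open>c = \<omega> (2 n)\<close>, and let \<open>H'\<close> be \<open>H\<close> truncated at degree \<open>2 n + 1\<close>. The derivative of \<open>H'\<close> along \<open>X\<close> is
  \<open>c x\<^bsup>2n\<^esup>\<close> up to terms of order \<open>2 n + 1\<close>, which is not yet definite because it may vanish for \<open>x = 0\<close>.
  As \<open>Q\<close> has order 2, the derivative of \<open>x y\<^bsup>2n-1\<^esup>\<close> is \<open>y\<^bsup>2n\<^esup>\<close> up to such terms, so that
  \<open>W = c (H' + c x y\<^bsup>2n-1\<^esup>)\<close> has derivative \<open>c\<^sup>2 (x\<^bsup>2n\<^esup> + y\<^bsup>2n\<^esup>)\<close> up to terms of order \<open>2 n + 1\<close>. On the center manifold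
  (class \<open>C\<^sup>1\<close> suffices) \<open>W\<close> is therefore strictly increasing along the orbits in a small punctured
  disc, and no periodic orbit is contained in the disc. Hence, at a center, each periodic orbit
  through a point \<open>p\<close> near the origin enters the disc from outside before it reaches \<open>p\<close>. For \<open>p\<close>
  tending to the origin the time from entry to \<open>p\<close> tends to infinity, so the orbit of a limit of
  the entry points never leaves the disc in forward time. Being periodic, it is contained in the
  disc, a contradiction.
\<close>

section \<open>Dynamics near an equilibrium\<close>

text \<open>The preimage of \<open>c\<close> in \<open>{a..b}\<close> is closed and, by the
  intermediate value theorem, nonempty; its infimum is the required time. A value above
  \<open>c\<close> at an earlier time would produce a still earlier hit.\<close>

lemma first_hitting_time:
  fixes g :: "real \<Rightarrow> real"
  assumes "a \<le> b" "continuous_on {a..b} g" "g a \<le> c" "c \<le> g b"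
  obtains t where "t \<in> {a..b}" "g t = c" "\<And>s. s \<in> {a..t} \<Longrightarrow> g s \<le> c"
proof -
  define A where "A = {t \<in> {a..b}. g t = c}"
  have ne: "A \<noteq> {}"
    using IVT'[of g a c b] assms by (auto simp: A_def)
  have "closed A"
    unfolding A_def
    using continuous_closed_preimage[OF assms(2) closed_atLeastAtMost, of "{c}"]
    by (simp add: vimage_def Int_def)
  moreover have bdd: "bdd_below A" by (auto simp: A_def intro!: bdd_belowI[of _ a])
  ultimately have InfA: "Inf A \<in> A" by (intro closed_contains_Inf[OF ne])
  show thesis
  proof
    show "Inf A \<in> {a..b}" "g (Inf A) = c" using InfA by (auto simp: A_def)
    show "g s \<le> c" if s: "s \<in> {a..Inf A}" for s
    proof (rule ccontr)
      assume "\<not> g s \<le> c"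
      have "continuous_on {a..s} g"
        by (rule continuous_on_subset[OF assms(2)]) (use s InfA in \<open>auto simp: A_def\<close>)
      then obtain t where t: "a \<le> t" "t \<le> s" "g t = c"
        using IVT'[of g a c s] assms s \<open>\<not> g s \<le> c\<close> by auto
      then have "t \<in> A" using s InfA by (auto simp: A_def)
      then have "Inf A \<le> t" using bdd by (rule cInf_lower)
      then have "s = t" using t s by auto
      then show False using t \<open>\<not> g s \<le> c\<close> by auto
    qed
  qed
qed

text \<open>Gronwall's argument for the squared distance \<open>e\<close>, which is differentiable
  also where the solutions meet. The bound \<open>\<bar>e'\<bar> \<le> 2 L e\<close> makes
  \<open>e s * exp (- 2 L s)\<close> nonincreasing and \<open>e s * exp (2 L s)\<close>
  nondecreasing, hence one estimate in each direction of time. The second one limits how fast a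
  solution can approach an equilibrium.\<close>

lemma norm_diff_solutions:
  fixes Y :: "'a::real_inner \<Rightarrow> 'a"
  assumes Y: "L-lipschitz_on S Y" and "0 \<le> t"
    and u: "\<And>s. (u has_vector_derivative Y (u s)) (at s)"
    and v: "\<And>s. (v has_vector_derivative Y (v s)) (at s)"
    and S: "\<And>s. s \<in> {0..t} \<Longrightarrow> u s \<in> S \<and> v s \<in> S"
  shows "norm (u t - v t) \<le> exp (L * t) * norm (u 0 - v 0)"
    and "norm (u 0 - v 0) \<le> exp (L * t) * norm (u t - v t)"
proof -
  define e where "e s = (u s - v s) \<bullet> (u s - v s)" for s
  have e': "(e has_real_derivative 2 * ((u s - v s) \<bullet> (Y (u s) - Y (v s)))) (at s)" for s
  proof -
    have d: "((\<lambda>s. u s - v s) has_derivative (\<lambda>h. h *\<^sub>R (Y (u s) - Y (v s)))) (at s)"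
      using has_vector_derivative_diff[OF u[of s] v[of s]]
      by (simp add: has_vector_derivative_def)
    show ?thesis
      unfolding e_def has_field_derivative_def
      by (rule has_derivative_eq_rhs[OF has_derivative_inner[OF d d]])
        (auto simp: fun_eq_iff inner_commute algebra_simps)
  qed
  have le: "\<bar>2 * ((u s - v s) \<bullet> (Y (u s) - Y (v s)))\<bar> \<le> 2 * L * e s" if "s \<in> {0..t}" for s
  proof -
    have "\<bar>(u s - v s) \<bullet> (Y (u s) - Y (v s))\<bar> \<le> norm (u s - v s) * norm (Y (u s) - Y (v s))"
      by (rule Cauchy_Schwarz_ineq2)
    also have "\<dots> \<le> norm (u s - v s) * (L * norm (u s - v s))"
      using lipschitz_onD[OF Y, of "u s" "v s"] S[OF that]
      by (intro mult_left_mono) (auto simp: dist_norm)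
    also have "\<dots> = L * e s"
      by (simp add: e_def power2_norm_eq_inner[symmetric] power2_eq_square)
    finally show ?thesis by simp
  qed
  have sq: "e s = (norm (u s - v s))\<^sup>2" for s by (simp add: e_def power2_norm_eq_inner)
  have "e t * exp (- 2 * L * t) \<le> e 0 * exp (- 2 * L * 0)"
    using \<open>0 \<le> t\<close>
  proof (rule DERIV_nonpos_imp_nonincreasing)
    fix s assume "0 \<le> s" "s \<le> t"
    then show "\<exists>y. ((\<lambda>s. e s * exp (- 2 * L * s)) has_real_derivative y) (at s) \<and> y \<le> 0"
      using le[of s]
      by (intro exI[of _ "(2 * ((u s - v s) \<bullet> (Y (u s) - Y (v s))) - 2 * L * e s) * exp (- 2 * L * s)"] conjI mult_nonpos_nonneg)
        (auto intro!: derivative_eq_intros e' simp: abs_le_iff algebra_simps)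
  qed
  then have "e t \<le> e 0 * exp (2 * L * t)" by (simp add: exp_minus field_simps)
  also have "\<dots> = (exp (L * t) * norm (u 0 - v 0))\<^sup>2"
    by (simp add: sq power_mult_distrib exp_double[symmetric] mult.commute mult.left_commute)
  finally show "norm (u t - v t) \<le> exp (L * t) * norm (u 0 - v 0)"
    unfolding sq by (rule power2_le_imp_le) simp
  have "e 0 * exp (2 * L * 0) \<le> e t * exp (2 * L * t)"
    using \<open>0 \<le> t\<close>
  proof (rule DERIV_nonneg_imp_nondecreasing)
    fix s assume "0 \<le> s" "s \<le> t"
    then show "\<exists>y. ((\<lambda>s. e s * exp (2 * L * s)) has_real_derivative y) (at s) \<and> 0 \<le> y"
      using le[of s]
      by (intro exI[of _ "(2 * ((u s - v s) \<bullet> (Y (u s) - Y (v s))) + 2 * L * e s) * exp (2 * L * s)"] conjI mult_nonneg_nonneg)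
        (auto intro!: derivative_eq_intros e' simp: abs_le_iff algebra_simps)
  qed
  then have "e 0 \<le> e t * exp (2 * L * t)" by simp
  also have "\<dots> = (exp (L * t) * norm (u t - v t))\<^sup>2"
    by (simp add: sq power_mult_distrib exp_double[symmetric] mult.commute mult.left_commute)
  finally show "norm (u 0 - v 0) \<le> exp (L * t) * norm (u t - v t)"
    unfolding sq by (rule power2_le_imp_le) simp
qed

text \<open>Solutions are never constructed here: \<open>orbits\<close> supplies a global periodic
  solution through every point of the punctured ball, in particular through the limit of the entry
  points. Gronwall's estimate then compares that solution with the approximating ones.\<close>

lemma no_periodic_orbits_near_equilibrium:
  fixes Y :: "'a::euclidean_space \<Rightarrow> 'a" and W :: "'a \<Rightarrow> real"
  assumes "d > 0" "L > 0" and Y: "L-lipschitz_on (cball 0 d) Y" and "Y 0 = 0"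
    and W: "\<And>p. p \<in> cball 0 d \<Longrightarrow> p \<noteq> 0 \<Longrightarrow> (W has_derivative W' p) (at p)"
    and W'_pos: "\<And>p. p \<in> cball 0 d \<Longrightarrow> p \<noteq> 0 \<Longrightarrow> W' p (Y p) > 0"
    and orbits: "\<And>p. p \<in> cball 0 d \<Longrightarrow> p \<noteq> 0 \<Longrightarrow> \<exists>\<gamma> T. T > 0 \<and> \<gamma> 0 = p \<and>
      (\<forall>t. (\<gamma> has_vector_derivative Y (\<gamma> t)) (at t) \<and> \<gamma> (t + T) = \<gamma> t \<and> \<gamma> t \<noteq> 0)"
  shows False
proof -
  \<comment> \<open>Orbits are trapped in the ball of radius \<open>\<delta>\<close>. The shell
    between \<open>\<delta>\<close> and \<open>d\<close> leaves room for an orbit to exceed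
    \<open>\<delta>\<close> while it is still in the region where \<open>Y\<close> is
    Lipschitz.\<close>
  define \<delta> where "\<delta> = d / 2"
  have \<delta>: "\<delta> > 0" "\<delta> < d" "d = 2 * \<delta>" using \<open>d > 0\<close> by (auto simp: \<delta>_def)
  have cont: "continuous_on A \<gamma>"
    if "\<And>t. (\<gamma> has_vector_derivative Y (\<gamma> t)) (at t)" for \<gamma> A
    using that by (meson continuous_at_imp_continuous_on has_vector_derivative_continuous)
  \<comment> \<open>Otherwise \<open>W\<close> would increase strictly along \<open>\<gamma>\<close>
    over a full period and yet return to its initial value.\<close>
  have leaves: "\<exists>t\<in>{0..T}. norm (\<gamma> t) > \<delta>"
    if T: "T > 0" and \<gamma>: "\<And>t. (\<gamma> has_vector_derivative Y (\<gamma> t)) (at t)"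
      and "\<gamma> T = \<gamma> 0" and nz: "\<And>t. \<gamma> t \<noteq> 0" for \<gamma> T
  proof (rule ccontr)
    assume "\<not> ?thesis"
    then have in_ball: "\<gamma> t \<in> cball 0 d" if "t \<in> {0..T}" for t
      using that \<delta> by (force simp: not_less)
    have "W (\<gamma> 0) < W (\<gamma> T)"
      using T
    proof (rule DERIV_pos_imp_increasing)
      fix t assume "0 \<le> t" "t \<le> T"
      then have t: "\<gamma> t \<in> cball 0 d" using in_ball by auto
      have "((\<lambda>t. W (\<gamma> t)) has_derivative (\<lambda>h. W' (\<gamma> t) (h *\<^sub>R Y (\<gamma> t)))) (at t)"
        using has_derivative_compose[OF \<gamma>[of t, unfolded has_vector_derivative_def] W[OF t nz]] .
      moreover have "(\<lambda>h. W' (\<gamma> t) (h *\<^sub>R Y (\<gamma> t))) = (*) (W' (\<gamma> t) (Y (\<gamma> t)))"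
        using has_derivative_linear[OF W[OF t nz]] by (auto simp: linear_cmul)
      ultimately show "\<exists>y. ((\<lambda>t. W (\<gamma> t)) has_real_derivative y) (at t) \<and> 0 < y"
        using W'_pos[OF t nz] by (auto simp: has_field_derivative_def)
    qed
    then show False using \<open>\<gamma> T = \<gamma> 0\<close> by simp
  qed
  have trapped: "\<exists>u. (\<forall>t. (u has_vector_derivative Y (u t)) (at t)) \<and> norm (u 0) = \<delta> \<and>
    (\<forall>t\<in>{0..\<tau>}. norm (u t) \<le> \<delta>)" if "\<tau> \<ge> 0" for \<tau>
  proof -
    obtain e :: 'a where e: "norm e = 1" by (metis SOME_Basis norm_Basis)
    \<comment> \<open>The direction is arbitrary; the norm is chosen so that descending from norm
      \<open>\<delta>\<close> to \<open>norm p\<close> takes at least time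
      \<open>\<tau>\<close>.\<close>
    define p where "p = (\<delta> * exp (- L * \<tau>)) *\<^sub>R e"
    have norm_p: "norm p = \<delta> * exp (- L * \<tau>)" using e \<delta> by (simp add: p_def)
    have "exp (- L * \<tau>) \<le> 1" using \<open>L > 0\<close> that by simp
    then have "norm p \<le> \<delta>" unfolding norm_p using \<delta> mult_left_le by (metis less_imp_le)
    moreover have "norm p \<noteq> 0" using norm_p \<delta> by simp
    ultimately have "p \<in> cball 0 d" "p \<noteq> 0" using \<delta> by (auto simp del: norm_eq_zero)
    then obtain \<gamma> T where \<gamma>: "T > 0" "\<gamma> 0 = p" "\<And>t. (\<gamma> has_vector_derivative Y (\<gamma> t)) (at t)"
      "\<And>t. \<gamma> (t + T) = \<gamma> t" "\<And>t. \<gamma> t \<noteq> 0"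
      using orbits by metis
    have "\<gamma> T = \<gamma> 0" using \<gamma>(4)[of 0] by simp
    then obtain t where t: "t \<in> {0..T}" "norm (\<gamma> t) > \<delta>" using leaves \<gamma> by metis
    have "\<gamma> (t - T) = \<gamma> t" using \<gamma>(4)[of "t - T"] by simp
    \<comment> \<open>Follow the orbit backwards from \<open>p\<close>. By periodicity it is outside
      the \<open>\<delta>\<close>-ball after backward time \<open>T - t\<close>, so there is a first
      backward time \<open>s\<close> at which it meets the sphere; \<open>\<gamma> (- s)\<close> is
      the entry point.\<close>
    with t obtain s where s: "s \<in> {0..T - t}" "norm (\<gamma> (- s)) = \<delta>"
      "\<And>r. r \<in> {0..s} \<Longrightarrow> norm (\<gamma> (- r)) \<le> \<delta>"
    proof -
      have "continuous_on {0..T - t} (\<lambda>r. norm (\<gamma> (- r)))"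
        by (intro continuous_intros continuous_on_compose2[OF cont[OF \<gamma>(3), of UNIV]]) auto
      then show ?thesis
        using first_hitting_time[of 0 "T - t" "\<lambda>r. norm (\<gamma> (- r))" \<delta>] that t
          \<open>norm p \<le> \<delta>\<close> \<gamma>(2) \<open>\<gamma> (t - T) = \<gamma> t\<close> by auto
    qed
    define u where "u r = \<gamma> (r - s)" for r
    have u': "(u has_vector_derivative Y (u r)) (at r)" for r
    proof -
      have "((\<lambda>r. r - s) has_vector_derivative 1) (at r)"
        by (auto intro!: derivative_eq_intros simp: has_vector_derivative_def)
      from vector_diff_chain_at[OF this \<gamma>(3)] show ?thesis
        by (simp add: o_def u_def[abs_def])
    qed
    have u_le: "norm (u r) \<le> \<delta>" if "r \<in> {0..s}" for r
      using s(3)[of "s - r"] that by (auto simp: u_def)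
    have zero': "((\<lambda>_. 0) has_vector_derivative Y 0) (at r)" for r
      using \<open>Y 0 = 0\<close> by simp
    \<comment> \<open>The second solution in the comparison is the equilibrium. As
      \<open>u 0\<close> has norm \<open>\<delta>\<close> and \<open>u s = p\<close>, this forces
      \<open>\<tau> \<le> s\<close>.\<close>
    have "norm (u 0 - 0) \<le> exp (L * s) * norm (u s - 0)"
      using s(1) by (intro norm_diff_solutions(2)[OF Y _ u' zero'])
        (use u_le \<delta> in \<open>force+\<close>)
    then have "\<delta> \<le> exp (L * s) * (\<delta> * exp (- L * \<tau>))"
      using s(2) norm_p \<gamma>(2) by (simp add: u_def)
    then have "1 \<le> exp (L * s) * exp (- L * \<tau>)" using \<delta>(1) by (simp add: field_simps)
    then have "L * \<tau> \<le> L * s" by (simp add: exp_add[symmetric])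
    then have "\<tau> \<le> s" using \<open>L > 0\<close> by simp
    then show ?thesis
      using u' u_le s(2) by (intro exI[of _ u]) (auto simp: u_def)
  qed
  then have "\<forall>k::nat. \<exists>u. (\<forall>t. (u has_vector_derivative Y (u t)) (at t)) \<and> norm (u 0) = \<delta> \<and>
    (\<forall>t\<in>{0..real k}. norm (u t) \<le> \<delta>)"
    by simp
  then obtain u where u: "\<And>k t. (u k has_vector_derivative Y (u k t)) (at t)"
    "\<And>k. norm (u k 0) = \<delta>" "\<And>k t. t \<in> {0..real k} \<Longrightarrow> norm (u k t) \<le> \<delta>"
    by metis
  \<comment> \<open>Compactness of the sphere yields a limit \<open>a\<close> of entry points whose
    orbits stay in the \<open>\<delta>\<close>-ball for longer and longer times.\<close>
  obtain a r where a: "a \<in> sphere 0 \<delta>" "strict_mono r" "(\<lambda>k. u (r k) 0) \<longlonglongrightarrow> a"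
    using seq_compactE[OF compact_imp_seq_compact[OF compact_sphere], of "\<lambda>k. u k 0" 0 \<delta>] u(2)
    by (auto simp: o_def)
  have "a \<in> cball 0 d" "a \<noteq> 0" using a(1) \<delta> by auto
  then obtain \<gamma> T where \<gamma>: "T > 0" "\<gamma> 0 = a" "\<And>t. (\<gamma> has_vector_derivative Y (\<gamma> t)) (at t)"
    "\<And>t. \<gamma> (t + T) = \<gamma> t" "\<And>t. \<gamma> t \<noteq> 0"
    using orbits by metis
  have "\<gamma> T = \<gamma> 0" using \<gamma>(4)[of 0] by simp
  then obtain t where t: "t \<in> {0..T}" "norm (\<gamma> t) > \<delta>" using leaves \<gamma> by metis
  \<comment> \<open>This level satisfies \<open>\<delta> < c \<le> d\<close>. Until it first reaches
    norm \<open>c\<close>, the orbit of \<open>a\<close> is in the ball where Gronwall's estimate is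
    available.\<close>
  define c where "c = min d (norm (\<gamma> t))"
  have "continuous_on {0..t} (\<lambda>s. norm (\<gamma> s))"
    by (intro continuous_intros cont \<gamma>(3))
  then obtain t0 where t0: "t0 \<in> {0..t}" "norm (\<gamma> t0) = c" "\<And>s. s \<in> {0..t0} \<Longrightarrow> norm (\<gamma> s) \<le> c"
    using first_hitting_time[of 0 t "\<lambda>s. norm (\<gamma> s)" c] t a(1) \<gamma>(2) \<delta> by (auto simp: c_def)
  \<comment> \<open>Since \<open>r k \<ge> k \<ge> t0\<close>, the approximating orbit is trapped on
    all of \<open>{0..t0}\<close>. In the limit \<open>norm (\<gamma> t0) \<le> \<delta>\<close>,
    which contradicts \<open>norm (\<gamma> t0) = c\<close>.\<close>
  have "norm (u (r k) t0 - \<gamma> t0) \<le> exp (L * t0) * norm (u (r k) 0 - a)" if k: "real k \<ge> t0" for k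
  proof -
    have "real k \<le> real (r k)" using seq_suble[OF a(2)] by simp
    then show ?thesis
      unfolding \<gamma>(2)[symmetric]
      using t0 u(3)[of _ "r k"] k \<delta>
      by (intro norm_diff_solutions(1)[OF Y _ u(1) \<gamma>(3)]) (force simp: c_def)+
  qed
  then have "\<forall>\<^sub>F k in sequentially. norm (u (r k) t0 - \<gamma> t0) \<le> exp (L * t0) * norm (u (r k) 0 - a)"
    by (intro eventually_mono[OF eventually_ge_at_top[of "nat \<lceil>t0\<rceil>"]]) (simp add: nat_ceiling_le_eq)
  moreover have "(\<lambda>k. exp (L * t0) * norm (u (r k) 0 - a)) \<longlonglongrightarrow> 0"
    using a(3) by (intro tendsto_mult_right_zero tendsto_norm_zero) (simp add: LIM_zero)
  ultimately have "(\<lambda>k. u (r k) t0 - \<gamma> t0) \<longlonglongrightarrow> 0"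
    by (rule Lim_null_comparison)
  then have "(\<lambda>k. norm (u (r k) t0)) \<longlonglongrightarrow> norm (\<gamma> t0)"
    by (intro tendsto_norm) (simp add: LIM_zero_iff)
  moreover have "\<forall>\<^sub>F k in sequentially. norm (u (r k) t0) \<le> \<delta>"
  proof (rule eventually_mono[OF eventually_ge_at_top[of "nat \<lceil>t0\<rceil>"]])
    fix k assume "k \<ge> nat \<lceil>t0\<rceil>"
    then have "t0 \<le> real k" by (simp add: nat_ceiling_le_eq)
    also have "real k \<le> real (r k)" using seq_suble[OF a(2)] by simp
    finally show "norm (u (r k) t0) \<le> \<delta>" using t0(1) by (intro u(3)) simp
  qed
  ultimately have "norm (\<gamma> t0) \<le> \<delta>"
    by (rule tendsto_upperbound) simp
  then show False using t0(2) t(2) \<delta> by (auto simp: c_def)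
qed

section \<open>Jets and their evaluation\<close>

text \<open>The three exponents are packed into one multi-index, so that componentwise addition of
  triples expresses products of monomials and of series.\<close>

definition coeff_at :: "fps3 \<Rightarrow> nat \<times> nat \<times> nat \<Rightarrow> real" where
  "coeff_at F = (\<lambda>(i, j, k). coeff3 F i j k)"

definition degree3 :: "nat \<times> nat \<times> nat \<Rightarrow> nat" where
  "degree3 = (\<lambda>(i, j, k). i + j + k)"

definition monom3 :: "nat \<times> nat \<times> nat \<Rightarrow> real \<times> real \<times> real \<Rightarrow> real" where
  "monom3 = (\<lambda>(i, j, k) (x, y, z). x ^ i * y ^ j * z ^ k)"

definition indices :: "nat \<Rightarrow> (nat \<times> nat \<times> nat) set" where
  "indices l = {a. degree3 a \<le> l}"

definition eval_jet :: "nat \<Rightarrow> fps3 \<Rightarrow> real \<times> real \<times> real \<Rightarrow> real" where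
  "eval_jet l F v = (\<Sum>a\<in>indices l. coeff_at F a * monom3 a v)"

lemma finite_indices [simp]: "finite (indices l)"
proof (rule finite_subset)
  show "indices l \<subseteq> {..l} \<times> {..l} \<times> {..l}"
    by (auto simp: indices_def degree3_def)
qed auto

lemma monom3_add: "monom3 (a + b) v = monom3 a v * monom3 b v"
  by (cases a; cases b; cases v) (auto simp: monom3_def power_add)

lemma abs_components_le_norm:
  fixes x y z :: real
  shows "\<bar>x\<bar> \<le> norm (x, y, z)" "\<bar>y\<bar> \<le> norm (x, y, z)" "\<bar>z\<bar> \<le> norm (x, y, z)"
  using norm_fst_le[of x "(y, z)"] norm_snd_le[of "(y, z)" x] norm_fst_le[of y z] norm_snd_le[of z y]
  by simp_all

lemma abs_monom3_le: "\<bar>monom3 a v\<bar> \<le> norm v ^ degree3 a"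
  by (cases a; cases v)
    (auto simp: monom3_def degree3_def abs_mult power_abs power_add
      intro!: mult_mono power_mono abs_components_le_norm)

lemma coeff_at_add: "coeff_at (F + G) a = coeff_at F a + coeff_at G a"
  by (cases a) (auto simp: coeff_at_def coeff3_def)

text \<open>Three nested Cauchy products merge into one convolution. The condition
  \<open>\<exists>b. c = a + b\<close> says that \<open>a\<close> is componentwise at most
  \<open>c\<close>, so that \<open>c - a\<close> is a true difference.\<close>

lemma coeff_at_mult: "coeff_at (F * G) c = (\<Sum>a | \<exists>b. c = a + b. coeff_at F a * coeff_at G (c - a))"
proof -
  obtain i j k where c: "c = (i, j, k)" by (cases c)
  have "coeff_at (F * G) c = (\<Sum>a1=0..i. \<Sum>a2=0..j. \<Sum>a3=0..k.
      coeff3 F a1 a2 a3 * coeff3 G (i - a1) (j - a2) (k - a3))"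
    by (simp add: c coeff_at_def coeff3_def fps_mult_nth fps_sum_nth)
  also have "\<dots> = (\<Sum>a\<in>{0..i} \<times> {0..j} \<times> {0..k}. coeff_at F a * coeff_at G (c - a))"
    by (simp add: sum.cartesian_product c coeff_at_def case_prod_unfold)
  also have "{0..i} \<times> {0..j} \<times> {0..k} = {a. \<exists>b. c = a + b}"
    by (auto simp: c intro: le_Suc_ex)
  finally show ?thesis .
qed

lemma eval_jet_single:
  assumes "\<And>a. coeff_at F a = (if a = a0 then c else 0)" "degree3 a0 \<le> l"
  shows "eval_jet l F v = c * monom3 a0 v"
proof -
  have "eval_jet l F v = (\<Sum>a\<in>indices l. if a = a0 then c * monom3 a0 v else 0)"
    unfolding eval_jet_def by (intro sum.cong) (auto simp: assms(1))
  moreover have "a0 \<in> indices l" using assms(2) by (simp add: indices_def)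
  ultimately show ?thesis by simp
qed

lemma coeff_at_var:
  "coeff_at var_x a = (if a = (1, 0, 0) then 1 else 0)"
  "coeff_at var_y a = (if a = (0, 1, 0) then 1 else 0)"
  "coeff_at var_z a = (if a = (0, 0, 1) then 1 else 0)"
  by (cases a, simp add: coeff_at_def coeff3_def var_x_def var_y_def var_z_def)+

lemma coeff_at_const3: "coeff_at (const3 c) a = (if a = (0, 0, 0) then c else 0)"
  by (cases a) (simp add: coeff_at_def coeff3_def const3_def)

lemma coeff_at_const3_var_x_power:
  "coeff_at (const3 c * var_x ^ m) a = (if a = (m, 0, 0) then c else 0)"
  by (cases a) (simp add: coeff_at_def coeff3_def const3_def var_x_def)

lemma eval_jet_cong:
  assumes "jet l F = jet l G"
  shows "eval_jet l F = eval_jet l G"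
proof -
  have "coeff_at F a = coeff_at G a" if "a \<in> indices l" for a
  proof -
    obtain i j k where a: "a = (i, j, k)" by (cases a)
    have "coeff_at (jet l F) a = coeff_at (jet l G) a" using assms by simp
    then show ?thesis
      using that by (simp add: a jet_def coeff_at_def coeff3_def indices_def degree3_def)
  qed
  then show ?thesis by (simp add: eval_jet_def fun_eq_iff)
qed

lemma coeff_at_deriv:
  "coeff_at (deriv_x F) (i, j, k) = real (Suc i) * coeff_at F (Suc i, j, k)"
  "coeff_at (deriv_y F) (i, j, k) = real (Suc j) * coeff_at F (i, Suc j, k)"
  "coeff_at (deriv_z F) (i, j, k) = real (Suc k) * coeff_at F (i, j, Suc k)"
proof -
  have nth: "fps_nth (of_nat m * f) q = of_nat m * fps_nth f q"
    for m q and f :: "'a::comm_semiring_1 fps"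
    by (simp flip: fps_of_nat)
  show "coeff_at (deriv_x F) (i, j, k) = real (Suc i) * coeff_at F (Suc i, j, k)"
    "coeff_at (deriv_y F) (i, j, k) = real (Suc j) * coeff_at F (i, Suc j, k)"
    "coeff_at (deriv_z F) (i, j, k) = real (Suc k) * coeff_at F (i, j, Suc k)"
    by (simp_all add: coeff_at_def coeff3_def deriv_x_def deriv_y_def deriv_z_def nth
        del: of_nat_Suc)
qed

text \<open>An index shift in one variable. Terms on the right with exponent 0 in that variable have
  factor 0, so the truncated \<open>i - 1\<close> does no harm; the order grows to
  \<open>Suc l\<close> because differentiation lowers degrees by one.\<close>

lemma eval_jet_deriv:
  "eval_jet l (deriv_x F) (x, y, z) =
    (\<Sum>(i, j, k)\<in>indices (Suc l). coeff_at F (i, j, k) * (real i * x ^ (i - 1) * y ^ j * z ^ k))"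
  "eval_jet l (deriv_y F) (x, y, z) =
    (\<Sum>(i, j, k)\<in>indices (Suc l). coeff_at F (i, j, k) * (x ^ i * (real j * y ^ (j - 1)) * z ^ k))"
  "eval_jet l (deriv_z F) (x, y, z) =
    (\<Sum>(i, j, k)\<in>indices (Suc l). coeff_at F (i, j, k) * (x ^ i * y ^ j * (real k * z ^ (k - 1))))"
  unfolding eval_jet_def
  subgoal
    by (rule sum.reindex_bij_witness_not_neutral[where S' = "{}" and
          T' = "{a \<in> indices (Suc l). fst a = 0}" and
          j = "\<lambda>(i, j, k). (Suc i, j, k)" and i = "\<lambda>(i, j, k). (i - 1, j, k)"])
      (auto simp: coeff_at_deriv indices_def degree3_def monom3_def intro: finite_subset[OF _ finite_indices[of "Suc l"]])
  subgoal
    by (rule sum.reindex_bij_witness_not_neutral[where S' = "{}" and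
          T' = "{a \<in> indices (Suc l). fst (snd a) = 0}" and
          j = "\<lambda>(i, j, k). (i, Suc j, k)" and i = "\<lambda>(i, j, k). (i, j - 1, k)"])
      (auto simp: coeff_at_deriv indices_def degree3_def monom3_def intro: finite_subset[OF _ finite_indices[of "Suc l"]])
  subgoal
    by (rule sum.reindex_bij_witness_not_neutral[where S' = "{}" and
          T' = "{a \<in> indices (Suc l). snd (snd a) = 0}" and
          j = "\<lambda>(i, j, k). (i, j, Suc k)" and i = "\<lambda>(i, j, k). (i, j, k - 1)"])
      (auto simp: coeff_at_deriv indices_def degree3_def monom3_def intro: finite_subset[OF _ finite_indices[of "Suc l"]])
  done

lemma has_derivative_eval_jet:
  "(eval_jet (Suc l) F has_derivative (\<lambda>(a, b, c). eval_jet l (deriv_x F) v * a +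
     eval_jet l (deriv_y F) v * b + eval_jet l (deriv_z F) v * c)) (at v)"
proof -
  obtain x y z where v: "v = (x, y, z)" by (cases v)
  have "((\<lambda>w. \<Sum>(i, j, k)\<in>indices (Suc l). coeff_at F (i, j, k) *
        (fst w ^ i * fst (snd w) ^ j * snd (snd w) ^ k)) has_derivative
      (\<lambda>w. \<Sum>(i, j, k)\<in>indices (Suc l). 
         coeff_at F (i, j, k) * (real i * x ^ (i - 1) * y ^ j * z ^ k) * fst w +
         coeff_at F (i, j, k) * (x ^ i * (real j * y ^ (j - 1)) * z ^ k) * fst (snd w) +
         coeff_at F (i, j, k) * (x ^ i * y ^ j * (real k * z ^ (k - 1))) * snd (snd w))) (at v)"
    unfolding case_prod_unfold
    by (rule has_derivative_eq_rhs, rule derivative_eq_intros)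
      (auto intro!: derivative_eq_intros simp: v fun_eq_iff algebra_simps)
  moreover have "eval_jet (Suc l) F = (\<lambda>w. \<Sum>(i, j, k)\<in>indices (Suc l). coeff_at F (i, j, k) *
        (fst w ^ i * fst (snd w) ^ j * snd (snd w) ^ k))"
    by (auto simp: eval_jet_def monom3_def fun_eq_iff case_prod_unfold)
  ultimately show ?thesis
    by (simp add: v eval_jet_deriv sum_distrib_right sum.distrib case_prod_unfold)
qed

section \<open>Agreement of functions with formal series up to a given order\<close>

text \<open>Only the \<open>l\<close>-jet of \<open>F\<close> matters, so the notion applies to
  divergent series as well. With the filter \<open>nhds 0\<close> the bound also holds at the origin
  itself, and it can be composed with maps that send 0 to 0.\<close>

definition approximates :: "nat \<Rightarrow> (real \<times> real \<times> real \<Rightarrow> real) \<Rightarrow> fps3 \<Rightarrow> bool" where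
  "approximates l f F \<longleftrightarrow> (\<lambda>v. f v - eval_jet l F v) \<in> O[nhds 0](\<lambda>v. norm v ^ Suc l)"

lemma norm_power_bigo:
  assumes "m \<le> n"
  shows "(\<lambda>v. norm v ^ n) \<in> O[nhds 0](\<lambda>v::'a::real_normed_vector. norm v ^ m)"
proof (rule bigoI[where c = 1])
  have "\<forall>\<^sub>F v in nhds (0::'a). norm v < 1"
    by (auto simp: eventually_nhds_metric dist_norm intro!: exI[of _ 1])
  then show "\<forall>\<^sub>F v in nhds (0::'a). norm (norm v ^ n) \<le> 1 * norm (norm v ^ m)"
    by eventually_elim (simp add: assms power_decreasing)
qed

lemma monom3_bigo:
  assumes "m \<le> degree3 a"
  shows "monom3 a \<in> O[nhds 0](\<lambda>v. norm v ^ m)"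
proof -
  have "monom3 a \<in> O[nhds 0](\<lambda>v. norm v ^ degree3 a)"
    by (rule bigoI[where c = 1]) (simp add: abs_monom3_le)
  then show ?thesis
    using norm_power_bigo[OF assms] by (rule landau_o.big_trans)
qed

lemma eval_jet_bigo_1: "eval_jet l F \<in> O[nhds 0](\<lambda>_. 1)"
proof -
  have "(\<lambda>v. \<Sum>a\<in>indices l. coeff_at F a * monom3 a v) \<in> O[nhds 0](\<lambda>v. norm v ^ 0)"
    by (intro big_sum_in_bigo) (simp add: monom3_bigo[of 0, simplified])
  then show ?thesis by (simp add: eval_jet_def[abs_def])
qed

lemma approximates_bigo_1:
  assumes "approximates l f F"
  shows "f \<in> O[nhds 0](\<lambda>_. 1)"
proof -
  have "(\<lambda>v. f v - eval_jet l F v) \<in> O[nhds 0](\<lambda>v. norm v ^ 0)"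
    using assms norm_power_bigo[of 0 "Suc l"] unfolding approximates_def
    by (rule landau_o.big_trans) simp
  from sum_in_bigo(1)[OF this[simplified] eval_jet_bigo_1[of l F]] show ?thesis by simp
qed

lemma eval_jet_add: "eval_jet l (F + G) v = eval_jet l F v + eval_jet l G v"
  by (simp add: eval_jet_def coeff_at_add algebra_simps sum.distrib)

text \<open>The product of the two polynomials contains every term of the jet of
  \<open>F * G\<close>; what remains is a finite sum of monomials of degree above
  \<open>l\<close>.\<close>

lemma eval_jet_mult:
  "(\<lambda>v. eval_jet l F v * eval_jet l G v - eval_jet l (F * G) v) \<in> O[nhds 0](\<lambda>v. norm v ^ Suc l)"
proof -
  define g where "g v = (\<lambda>(a, b). coeff_at F a * coeff_at G b * monom3 (a + b) v)" for v
  \<comment> \<open>The pairs in \<open>A\<close> make up the jet of the product, the other pairs of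
    indices the error.\<close>
  define A where "A = {(a, b). degree3 (a + b) \<le> l}"
  have fin: "finite (indices l \<times> indices l)" by simp
  have A: "A \<subseteq> indices l \<times> indices l"
    by (auto simp: A_def indices_def degree3_def)
  have prod: "eval_jet l F v * eval_jet l G v = sum (g v) (indices l \<times> indices l)" for v
    unfolding eval_jet_def sum_product sum.cartesian_product g_def
    by (intro sum.cong) (auto simp: monom3_add)
  have "eval_jet l F v * eval_jet l G v - eval_jet l (F * G) v
      = sum (g v) (indices l \<times> indices l - A)" for v
  proof -
    have fin': "finite {a. \<exists>b. c = a + b}" if "c \<in> indices l" for c
    proof (rule finite_subset)
      show "{a. \<exists>b. c = a + b} \<subseteq> indices l"
        using that by (auto simp: indices_def degree3_def)
    qed simp
    have "eval_jet l (F * G) v = (\<Sum>c\<in>indices l. \<Sum>a | \<exists>b. c = a + b.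
        coeff_at F a * coeff_at G (c - a) * monom3 c v)"
      by (simp add: eval_jet_def coeff_at_mult sum_distrib_right)
    also have "\<dots> = (\<Sum>(c, a)\<in>(SIGMA c:indices l. {a. \<exists>b. c = a + b}).
        coeff_at F a * coeff_at G (c - a) * monom3 c v)"
      using fin' by (intro sum.Sigma) simp_all
    also have "\<dots> = sum (g v) A"
      by (rule sum.reindex_bij_witness[where i = "\<lambda>(a, b). (a + b, a)" and j = "\<lambda>(c, a). (a, c - a)"])
        (auto simp: A_def g_def indices_def)
    finally show ?thesis
      using sum_diff[OF fin A, of "g v"] by (simp add: prod)
  qed
  moreover have "(\<lambda>v. sum (g v) (indices l \<times> indices l - A)) \<in> O[nhds 0](\<lambda>v. norm v ^ Suc l)"
    by (intro big_sum_in_bigo) (auto simp: g_def A_def case_prod_unfold simp del: power_Suc intro: monom3_bigo)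
  ultimately show ?thesis by simp
qed

lemma approximates_add:
  assumes "approximates l f F" "approximates l g G"
  shows "approximates l (\<lambda>v. f v + g v) (F + G)"
  using sum_in_bigo(1)[OF assms[unfolded approximates_def]]
  by (simp add: approximates_def eval_jet_add algebra_simps)

text \<open>Replace one factor at a time by its jet and then apply \<open>eval_jet_mult\<close>; the
  factors left over are bounded near the origin.\<close>

lemma approximates_mult:
  assumes f: "approximates l f F" and g: "approximates l g G"
  shows "approximates l (\<lambda>v. f v * g v) (F * G)"
proof -
  note f' = f[unfolded approximates_def] and g' = g[unfolded approximates_def]
  have "(\<lambda>v. (f v - eval_jet l F v) * g v + eval_jet l F v * (g v - eval_jet l G v) +
      (eval_jet l F v * eval_jet l G v - eval_jet l (F * G) v)) \<in> O[nhds 0](\<lambda>v. norm v ^ Suc l)"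
    using landau_o.big.mult[OF f' approximates_bigo_1[OF g]]
      landau_o.big.mult[OF eval_jet_bigo_1 g', of l F] eval_jet_mult[of l F G]
    by (intro sum_in_bigo(1)) simp_all
  then show ?thesis by (simp add: approximates_def algebra_simps)
qed

lemma approximates_eval_jet: "approximates l (eval_jet l F) F"
  by (simp add: approximates_def)

lemma approximates_var:
  assumes "l > 0"
  shows "approximates l (\<lambda>(x, y, z). y) var_y" "approximates l (\<lambda>(x, y, z). z) var_z"
  using assms
  by (simp_all add: approximates_def case_prod_unfold degree3_def monom3_def
      eval_jet_single[OF coeff_at_var(2)] eval_jet_single[OF coeff_at_var(3)])

lemma approximates_const3: "approximates l (\<lambda>_. c) (const3 c)"
  by (simp add: approximates_def case_prod_unfold degree3_def monom3_def
      eval_jet_single[OF coeff_at_const3])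

section \<open>Convergent power series: Taylor remainder and Lipschitz continuity\<close>

text \<open>Evaluating at \<open>(t, t, t)\<close> turns convergence of the series into a weighted \<open>\<ell>\<^sup>1\<close>-bound on
  its coefficients.\<close>

lemma has_power_series_at_weighted_summable:
  assumes "has_power_series_at f F (0, 0, 0)"
  obtains t C :: real where "t > 0" "((\<lambda>a. \<bar>coeff_at F a\<bar> * t ^ degree3 a) has_sum C) UNIV"
    "\<forall>v\<in>cball 0 t. ((\<lambda>a. coeff_at F a * monom3 a v) has_sum f v) UNIV"
proof -
  from assms obtain \<rho> where \<rho>: "\<rho> > 0" "\<And>x y z. \<bar>x\<bar> < \<rho> \<and> \<bar>y\<bar> < \<rho> \<and> \<bar>z\<bar> < \<rho> \<Longrightarrow>
        ((\<lambda>(i, j, k). coeff3 F i j k * x ^ i * y ^ j * z ^ k) has_sum f (x, y, z)) UNIV"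
    unfolding has_power_series_at_def by auto
  have eq: "(\<lambda>(i, j, k). coeff3 F i j k * x ^ i * y ^ j * z ^ k) = (\<lambda>a. coeff_at F a * monom3 a (x, y, z))"
    for x y z by (auto simp: fun_eq_iff coeff_at_def monom3_def)
  have sums: "((\<lambda>a. coeff_at F a * monom3 a v) has_sum f v) UNIV" if "norm v \<le> \<rho> / 2" for v
  proof -
    obtain x y z where v: "v = (x, y, z)" by (cases v)
    show ?thesis
      using \<rho>(2)[of x y z] abs_components_le_norm[where x = x and y = y and z = z] that \<rho>(1)
      unfolding eq v by force
  qed
  define t where "t = \<rho> / 2"
  have "(\<lambda>a. coeff_at F a * monom3 a (t, t, t)) summable_on UNIV"
  proof (rule has_sum_imp_summable)
    show "((\<lambda>a. coeff_at F a * monom3 a (t, t, t)) has_sum f (t, t, t)) UNIV"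
      unfolding eq[symmetric] by (rule \<rho>(2)) (use \<rho>(1) in \<open>simp add: t_def\<close>)
  qed
  then have "(\<lambda>a. norm (coeff_at F a * monom3 a (t, t, t))) summable_on UNIV"
    by (rule summable_on_iff_abs_summable_on_real[THEN iffD1])
  moreover have "norm (coeff_at F a * monom3 a (t, t, t)) = \<bar>coeff_at F a\<bar> * t ^ degree3 a" for a
    using \<rho>(1) by (cases a) (simp add: t_def abs_mult monom3_def degree3_def power_add power_abs)
  ultimately obtain C where "((\<lambda>a. \<bar>coeff_at F a\<bar> * t ^ degree3 a) has_sum C) UNIV"
    unfolding summable_on_def by auto
  then show thesis using that[of t C] \<rho>(1) sums by (simp add: t_def)
qed

text \<open>For \<open>norm v \<le> t\<close> each term of degree above \<open>l\<close> is at most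
  \<open>(norm v / t) ^ Suc l\<close> times its counterpart in the weighted series, whose sum is
  \<open>C\<close>.\<close>

lemma has_power_series_at_approximates:
  assumes "has_power_series_at f F (0, 0, 0)"
  shows "approximates l f F"
proof -
  obtain t C where t: "t > 0" "((\<lambda>a. \<bar>coeff_at F a\<bar> * t ^ degree3 a) has_sum C) UNIV"
    "\<forall>v\<in>cball 0 t. ((\<lambda>a. coeff_at F a * monom3 a v) has_sum f v) UNIV"
    by (rule has_power_series_at_weighted_summable[OF assms])
  have "norm (f v - eval_jet l F v) \<le> C / t ^ Suc l * norm (norm v ^ Suc l)" if v: "norm v \<le> t" for v
  proof -
    have "((\<lambda>a. if a \<in> indices l then coeff_at F a * monom3 a v else 0) has_sum eval_jet l F v) UNIV"
      by (rule has_sum_finite_neutralI[OF finite_indices[of l]]) (auto simp: eval_jet_def)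
    from has_sum_add[OF bspec[OF t(3)] has_sum_uminusI[OF this], of v] v
    have "((\<lambda>a. if a \<in> indices l then 0 else coeff_at F a * monom3 a v) has_sum (f v - eval_jet l F v)) UNIV"
      by (simp add: if_distrib cong: if_cong)
    moreover have "((\<lambda>a. (norm v / t) ^ Suc l * (\<bar>coeff_at F a\<bar> * t ^ degree3 a)) has_sum
        ((norm v / t) ^ Suc l * C)) UNIV"
      by (rule has_sum_cmult_right[OF t(2)])
    ultimately have "norm (f v - eval_jet l F v) \<le> (norm v / t) ^ Suc l * C"
    proof (rule norm_infsum_le)
      fix a
      show "norm (if a \<in> indices l then 0 else coeff_at F a * monom3 a v)
          \<le> (norm v / t) ^ Suc l * (\<bar>coeff_at F a\<bar> * t ^ degree3 a)"
      proof (cases "a \<in> indices l")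
        case False
        have "\<bar>monom3 a v\<bar> \<le> (norm v / t) ^ degree3 a * t ^ degree3 a"
          using abs_monom3_le[of a v] t(1) by (simp add: power_divide)
        also have "\<dots> \<le> (norm v / t) ^ Suc l * t ^ degree3 a"
          using False t(1) v by (intro mult_right_mono power_decreasing) (auto simp: indices_def)
        finally have "\<bar>coeff_at F a\<bar> * \<bar>monom3 a v\<bar> \<le> \<bar>coeff_at F a\<bar> * ((norm v / t) ^ Suc l * t ^ degree3 a)"
          by (rule mult_left_mono) simp
        then show ?thesis using False by (simp add: abs_mult mult_ac)
      qed (use t(1) in simp)
    qed
    then show ?thesis by (simp add: power_divide mult.commute)
  qed
  moreover have "\<forall>\<^sub>F v in nhds (0 :: real \<times> real \<times> real). norm v \<le> t"
    using t(1) by (auto simp: eventually_nhds_metric dist_norm intro!: exI[of _ t])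
  ultimately show ?thesis
    unfolding approximates_def by (intro bigoI[where c = "C / t ^ Suc l"]) (auto elim: eventually_mono)
qed

lemma abs_power_diff_le:
  fixes x y s :: real
  assumes "\<bar>x\<bar> \<le> s" "\<bar>y\<bar> \<le> s" "s > 0"
  shows "\<bar>x ^ n - y ^ n\<bar> \<le> (2 * s) ^ n / s * \<bar>x - y\<bar>"
proof (induction n)
  case (Suc n)
  have "x ^ Suc n - y ^ Suc n = x * (x ^ n - y ^ n) + (x - y) * y ^ n" by (simp add: algebra_simps)
  also have "\<bar>\<dots>\<bar> \<le> \<bar>x\<bar> * \<bar>x ^ n - y ^ n\<bar> + \<bar>x - y\<bar> * \<bar>y\<bar> ^ n"
    using abs_triangle_ineq[of "x * (x ^ n - y ^ n)" "(x - y) * y ^ n"] by (simp add: abs_mult power_abs)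
  also have "\<dots> \<le> s * ((2 * s) ^ n / s * \<bar>x - y\<bar>) + \<bar>x - y\<bar> * (2 * s) ^ n"
  proof (intro add_mono mult_mono order_refl)
    show "\<bar>y\<bar> ^ n \<le> (2 * s) ^ n"
      using assms(2,3) by (intro power_mono) linarith+
  qed (use assms(1,3) Suc.IH in simp_all)
  also have "\<dots> = (2 * s) ^ Suc n / s * \<bar>x - y\<bar>" using assms(3) by simp
  finally show ?case .
qed (use assms(3) in simp)

text \<open>The three variables are changed one at a time.\<close>

lemma abs_monom3_diff_le:
  assumes "norm v \<le> s" "norm w \<le> s" "s > 0"
  shows "\<bar>monom3 a v - monom3 a w\<bar> \<le> 3 / s * (2 * s) ^ degree3 a * norm (v - w)"
proof -
  obtain i j k x y z x' y' z' where e: "a = (i, j, k)" "v = (x, y, z)" "w = (x', y', z')"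
    by (cases a; cases v; cases w)
  let ?S = "2 * s"
  have b: "\<bar>x\<bar> \<le> s" "\<bar>y\<bar> \<le> s" "\<bar>z\<bar> \<le> s" "\<bar>x'\<bar> \<le> s" "\<bar>y'\<bar> \<le> s" "\<bar>z'\<bar> \<le> s"
    using assms(1,2)[unfolded e] by (auto intro: order_trans[OF abs_components_le_norm(1)]
      order_trans[OF abs_components_le_norm(2)] order_trans[OF abs_components_le_norm(3)])
  have d: "\<bar>x - x'\<bar> \<le> norm (v - w)" "\<bar>y - y'\<bar> \<le> norm (v - w)" "\<bar>z - z'\<bar> \<le> norm (v - w)"
    using abs_components_le_norm[where x = "x - x'" and y = "y - y'" and z = "z - z'"] by (simp_all add: e)
  have pw: "\<bar>p ^ m\<bar> \<le> ?S ^ m" if "\<bar>p\<bar> \<le> s" for p m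
    unfolding power_abs using that assms by (intro power_mono) auto
  have df: "\<bar>p ^ m - q ^ m\<bar> \<le> ?S ^ m / s * norm (v - w)"
    if "\<bar>p\<bar> \<le> s" "\<bar>q\<bar> \<le> s" "\<bar>p - q\<bar> \<le> norm (v - w)" for p q m
    using abs_power_diff_le[OF that(1,2) assms(3), of m] that(3) assms(3)
    by (elim order_trans) (intro mult_left_mono, auto)
  have "monom3 a v - monom3 a w = (x ^ i - x' ^ i) * (y ^ j * z ^ k) + x' ^ i * ((y ^ j - y' ^ j) * z ^ k)
     + x' ^ i * (y' ^ j * (z ^ k - z' ^ k))"
    by (simp add: e monom3_def algebra_simps)
  also have "\<bar>\<dots>\<bar> \<le> \<bar>x ^ i - x' ^ i\<bar> * (\<bar>y ^ j\<bar> * \<bar>z ^ k\<bar>) + \<bar>x' ^ i\<bar> * (\<bar>y ^ j - y' ^ j\<bar> * \<bar>z ^ k\<bar>)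
     + \<bar>x' ^ i\<bar> * (\<bar>y' ^ j\<bar> * \<bar>z ^ k - z' ^ k\<bar>)"
    unfolding abs_mult[symmetric] by (intro order_trans[OF abs_triangle_ineq] add_right_mono order_refl)
  also have "\<dots> \<le> (?S ^ i / s * norm (v - w)) * (?S ^ j * ?S ^ k) + ?S ^ i * ((?S ^ j / s * norm (v - w)) * ?S ^ k)
     + ?S ^ i * (?S ^ j * (?S ^ k / s * norm (v - w)))"
    using assms(3) by (intro add_mono mult_mono pw df b d) simp_all
  also have "\<dots> = 3 / s * (?S ^ i * ?S ^ j * ?S ^ k) * norm (v - w)"
    by simp
  also have "?S ^ i * ?S ^ j * ?S ^ k = ?S ^ degree3 a"
    by (simp add: e degree3_def power_add)
  finally show ?thesis .
qed

lemma has_power_series_at_lipschitz: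
  assumes "has_power_series_at f F (0, 0, 0)"
  obtains s K where "s > 0" "K-lipschitz_on (cball 0 s) f"
proof -
  obtain t C where t: "t > 0" "((\<lambda>a. \<bar>coeff_at F a\<bar> * t ^ degree3 a) has_sum C) UNIV"
    "\<forall>v\<in>cball 0 t. ((\<lambda>a. coeff_at F a * monom3 a v) has_sum f v) UNIV"
    by (rule has_power_series_at_weighted_summable[OF assms])
  \<comment> \<open>Then the weights \<open>(2 * s) ^ degree3 a\<close> of the monomial estimate are
    exactly the summable weights \<open>t ^ degree3 a\<close>, and Lipschitz bounds can be added
    term by term.\<close>
  define s where "s = t / 2"
  have "s > 0" using t(1) by (simp add: s_def)
  have "(3 / s * C)-lipschitz_on (cball 0 s) f"
  proof (rule lipschitz_onI)
    show "0 \<le> 3 / s * C"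
      using \<open>s > 0\<close> t(1) has_sum_nonneg[OF t(2)] by simp
    fix v w :: "real \<times> real \<times> real"
    assume "v \<in> cball 0 s" "w \<in> cball 0 s"
    then have vw: "norm v \<le> s" "norm w \<le> s" "norm v \<le> t" "norm w \<le> t" using t(1) by (auto simp: s_def)
    have "((\<lambda>a. coeff_at F a * monom3 a v + - (coeff_at F a * monom3 a w)) has_sum (f v + - f w)) UNIV"
      by (intro has_sum_add has_sum_uminusI bspec[OF t(3)]) (use vw in auto)
    moreover have "((\<lambda>a. 3 / s * norm (v - w) * (\<bar>coeff_at F a\<bar> * t ^ degree3 a)) has_sum
        (3 / s * norm (v - w) * C)) UNIV"
      by (rule has_sum_cmult_right[OF t(2)])
    ultimately have "norm (f v + - f w) \<le> 3 / s * norm (v - w) * C"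
    proof (rule norm_infsum_le)
      fix a
      have "\<bar>coeff_at F a\<bar> * \<bar>monom3 a v - monom3 a w\<bar> \<le>
          \<bar>coeff_at F a\<bar> * (3 / s * (2 * s) ^ degree3 a * norm (v - w))"
        by (intro mult_left_mono abs_monom3_diff_le vw \<open>s > 0\<close>) simp
      then show "norm (coeff_at F a * monom3 a v + - (coeff_at F a * monom3 a w))
          \<le> 3 / s * norm (v - w) * (\<bar>coeff_at F a\<bar> * t ^ degree3 a)"
        by (simp add: s_def abs_mult mult_ac flip: right_diff_distrib)
    qed
    then show "dist (f v) (f w) \<le> 3 / s * C * dist v w"
      by (simp add: dist_norm mult_ac)
  qed
  then show thesis using that \<open>s > 0\<close> by blast
qed

section \<open>The reduced system\<close>

text \<open>The invariance equation: the solution through a point of the graph satisfies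
  \<open>z = h (x, y)\<close> for small times. Differentiate both sides at time 0 and use uniqueness
  of derivatives.\<close>

lemma locally_invariant_graph_derivative:
  assumes inv: "locally_invariant (vector_field lam P Q R) (graph_over D h)"
    and p: "(x, y) \<in> D" and h': "(h has_derivative h') (at (x, y))"
  shows "h' (reduced_field P Q h (x, y)) = - lam * h (x, y) + R (x, y, h (x, y))"
proof -
  let ?X = "vector_field lam P Q R" and ?w = "(x, y, h (x, y))"
  have "?w \<in> graph_over D h" using p by (auto simp: graph_over_def)
  with inv obtain \<epsilon> u where u: "\<epsilon> > 0" "u 0 = ?w"
    "\<And>t. t \<in> {-\<epsilon><..<\<epsilon>} \<Longrightarrow> u t \<in> graph_over D h \<and> (u has_vector_derivative ?X (u t)) (at t)"
    unfolding locally_invariant_def by metis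
  have u': "(u has_derivative (\<lambda>t. t *\<^sub>R ?X ?w)) (at 0)"
    using u(3)[of 0] u(1,2) by (simp add: has_vector_derivative_def)
  note fst' = has_derivative_fst[OF u'] and snd' = has_derivative_snd[OF u']
  note planar = has_derivative_Pair[OF fst' has_derivative_fst[OF snd']]
  have "(h has_derivative h') (at (fst (u 0), fst (snd (u 0))))" using h' u(2) by simp
  from has_derivative_compose[OF planar this]
  have "((\<lambda>t. h (fst (u t), fst (snd (u t)))) has_derivative
      (\<lambda>t. h' (t *\<^sub>R reduced_field P Q h (x, y)))) (at 0)"
    by (simp add: vector_field_def reduced_field_def)
  moreover have "h (fst (u t), fst (snd (u t))) = snd (snd (u t))" if "t \<in> {-\<epsilon><..<\<epsilon>}" for t
    using u(3)[OF that] by (auto simp: graph_over_def)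
  ultimately have "((\<lambda>t. snd (snd (u t))) has_derivative
      (\<lambda>t. h' (t *\<^sub>R reduced_field P Q h (x, y)))) (at 0)"
    using u(1) by (elim has_derivative_transform_within_open[where s = "{-\<epsilon><..<\<epsilon>}"]) auto
  from has_derivative_unique[OF this has_derivative_snd[OF snd']] show ?thesis
    by (auto simp: vector_field_def dest: fun_cong[where x = 1])
qed

section \<open>Lipschitz bounds on the surface and for the planar field\<close>

text \<open>On a compact disc the continuous partial derivatives are bounded; convexity turns this
  into a Lipschitz bound.\<close>

lemma class_C_1_lipschitz:
  assumes "class_C 1 D h" "open D" "p \<in> D"
  obtains s K where "s > 0" "cball p s \<subseteq> D" "K-lipschitz_on (cball p s) h"
proof -
  obtain fx fy where f: "\<And>q. q \<in> D \<Longrightarrow> (h has_derivative (\<lambda>(u, v). fx q * u + fy q * v)) (at q)"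
    "continuous_on D fx" "continuous_on D fy"
    using assms(1) by auto
  obtain s where s: "s > 0" "cball p s \<subseteq> D"
    using assms(2,3) open_contains_cball by blast
  have "compact (cball p s)" by simp
  then have "bounded (fx ` cball p s)" "bounded (fy ` cball p s)"
    using f(2,3) s(2) by (meson compact_continuous_image compact_imp_bounded continuous_on_subset)+
  then obtain A B where AB: "\<And>q. q \<in> cball p s \<Longrightarrow> \<bar>fx q\<bar> \<le> A" "\<And>q. q \<in> cball p s \<Longrightarrow> \<bar>fy q\<bar> \<le> B"
    unfolding bounded_real by (metis imageI)
  have nonneg: "0 \<le> A + B" using AB[of p] s(1) by simp
  have "(A + B)-lipschitz_on (cball p s) h"
  proof (rule bounded_derivative_imp_lipschitz)
    show "(h has_derivative (\<lambda>(u, v). fx q * u + fy q * v)) (at q within cball p s)" if "q \<in> cball p s" for q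
      using f(1) that s(2) has_derivative_at_withinI by blast
    show "onorm (\<lambda>(u, v). fx q * u + fy q * v) \<le> A + B" if "q \<in> cball p s" for q
    proof (rule onorm_bound)
      fix w :: "real \<times> real"
      obtain u v where w: "w = (u, v)" by (cases w)
      have "\<bar>fx q * u + fy q * v\<bar> \<le> \<bar>fx q\<bar> * \<bar>u\<bar> + \<bar>fy q\<bar> * \<bar>v\<bar>"
        by (metis abs_mult abs_triangle_ineq)
      also have "\<dots> \<le> A * norm w + B * norm w"
        using AB[OF that] norm_fst_le[of u v] norm_snd_le[of v u]
        by (intro add_mono mult_mono) (auto simp: w)
      finally show "norm (case w of (u, v) \<Rightarrow> fx q * u + fy q * v) \<le> (A + B) * norm w"
        by (simp add: w algebra_simps)
    qed (rule nonneg)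
  qed (use nonneg in auto)
  then show thesis using that s by blast
qed

definition lift_to_graph :: "(real \<times> real \<Rightarrow> real) \<Rightarrow> real \<times> real \<Rightarrow> real \<times> real \<times> real" where
  "lift_to_graph h = (\<lambda>(x, y). (x, y, h (x, y)))"

lemma norm_lift_to_graph_le:
  assumes "\<bar>h p\<bar> \<le> K * norm p"
  shows "norm (lift_to_graph h p) \<le> (2 + K) * norm p"
proof -
  obtain x y where p: "p = (x, y)" by (cases p)
  have "norm (lift_to_graph h p) \<le> norm x + norm (y, h p)"
    using norm_Pair_le[of x "(y, h p)"] by (simp add: p lift_to_graph_def)
  also have "norm (y, h p) \<le> norm y + norm (h p)" by (rule norm_Pair_le)
  also have "norm x + (norm y + norm (h p)) \<le> norm p + (norm p + K * norm p)"
    using norm_fst_le[of x y] norm_snd_le[of y x] assms by (intro add_mono) (auto simp: p)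
  finally show ?thesis by (simp add: algebra_simps)
qed

lemma lipschitz_reduced_field:
  assumes P: "K1-lipschitz_on (cball 0 s1) P" "s1 > 0" and Q: "K2-lipschitz_on (cball 0 s2) Q" "s2 > 0"
    and h: "K-lipschitz_on (cball 0 s) h" "s > 0" "h 0 = 0"
  obtains t L where "t > 0" "L-lipschitz_on (cball 0 t) (reduced_field P Q h)"
proof -
  have K: "K \<ge> 0" using h(1) lipschitz_on_nonneg by blast
  \<comment> \<open>Lifting to the graph enlarges norms by at most the factor \<open>2 + K\<close>,
    so the lifted disc lies in the balls where \<open>P\<close> and \<open>Q\<close> are
    Lipschitz.\<close>
  define t where "t = min s (min s1 s2 / (2 + K))"
  have t: "t > 0" "t \<le> s" using assms K by (simp_all add: t_def)
  have "t \<le> min s1 s2 / (2 + K)" by (simp add: t_def)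
  then have "(2 + K) * t \<le> min s1 s2" using K by (simp add: pos_le_divide_eq mult.commute)
  then have t': "(2 + K) * t \<le> s1" "(2 + K) * t \<le> s2" by simp_all
  have hK: "\<bar>h p\<bar> \<le> K * norm p" if "p \<in> cball 0 t" for p
    using lipschitz_on_normD[OF h(1), of p 0] that t h(2,3) by simp
  have lift_in: "lift_to_graph h p \<in> cball 0 r" if "p \<in> cball 0 t" "(2 + K) * t \<le> r" for p r
  proof -
    have "norm (lift_to_graph h p) \<le> (2 + K) * norm p" by (intro norm_lift_to_graph_le hK that(1))
    also have "\<dots> \<le> (2 + K) * t" using that K by (intro mult_left_mono) auto
    finally show ?thesis using that by simp
  qed
  have lift_eq: "lift_to_graph h = (\<lambda>p. (fst p, snd p, h p))"
    by (auto simp: lift_to_graph_def)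
  have fst_l: "1-lipschitz_on (cball 0 t) (fst :: real \<times> real \<Rightarrow> real)"
    and snd_l: "1-lipschitz_on (cball 0 t) (snd :: real \<times> real \<Rightarrow> real)"
    by (rule lipschitz_onI; simp add: dist_fst_le dist_snd_le)+
  have h_l: "K-lipschitz_on (cball 0 t) h"
    using lipschitz_on_subset[OF h(1)] t by (simp add: subset_cball)
  obtain M where M: "M-lipschitz_on (cball 0 t) (lift_to_graph h)"
    unfolding lift_eq using lipschitz_on_Pair[OF fst_l lipschitz_on_Pair[OF snd_l h_l]] by blast
  have P_l: "(K1 * M)-lipschitz_on (cball 0 t) (\<lambda>p. P (lift_to_graph h p))"
    using lift_in t' by (intro lipschitz_on_compose2[OF M] lipschitz_on_subset[OF P(1)]) blast
  have Q_l: "(K2 * M)-lipschitz_on (cball 0 t) (\<lambda>p. Q (lift_to_graph h p))"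
    using lift_in t' by (intro lipschitz_on_compose2[OF M] lipschitz_on_subset[OF Q(1)]) blast
  have "reduced_field P Q h = (\<lambda>p. (snd p + P (lift_to_graph h p), Q (lift_to_graph h p)))"
    by (auto simp: reduced_field_def lift_to_graph_def)
  then show thesis
    using that[OF t(1)] lipschitz_on_Pair[OF lipschitz_on_add[OF snd_l P_l] Q_l] by auto
qed

lemma norm_power_le_sum_powers:
  fixes x y :: real
  shows "norm (x, y) ^ (2 * n) \<le> 4 ^ n * (x ^ (2 * n) + y ^ (2 * n))"
proof -
  define m where "m = max \<bar>x\<bar> \<bar>y\<bar>"
  have "norm (x, y) \<le> 2 * m" using norm_Pair_le[of x y] by (auto simp: m_def)
  then have "norm (x, y) ^ (2 * n) \<le> (2 * m) ^ (2 * n)" by (intro power_mono) auto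
  also have "\<dots> = 4 ^ n * m ^ (2 * n)" by (simp add: power_mult_distrib power_mult)
  also have "m ^ (2 * n) \<le> x ^ (2 * n) + y ^ (2 * n)"
    by (auto simp: m_def max_def power_even_abs)
  finally show ?thesis by simp
qed

lemma approximates_0_bigo:
  assumes "approximates 1 f F" "jet 1 F = 0"
  shows "f \<in> O[nhds 0](\<lambda>v. norm v ^ 2)"
proof -
  have "jet 1 F = jet 1 0" 
    unfolding assms(2) by (simp add: jet_def coeff3_def fps_eq_iff)
  then have "eval_jet 1 F v = 0" for v
    using eval_jet_cong[of 1 F 0] by (auto simp: eval_jet_def coeff_at_def coeff3_def)
  then show ?thesis using assms(1) by (simp add: approximates_def numeral_2_eq_2)
qed

text \<open>The link between the formal series \<open>XH\<close> and an actual derivative.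
  \<open>H\<close> need not converge: only jets of its formal partial derivatives enter, and these
  are the true partial derivatives of the truncation of \<open>H\<close> at degree
  \<open>Suc l\<close>.\<close>

lemma approximates_lie_derivative:
  assumes "l > 0" "approximates l P Pf" "approximates l Q Qf" "approximates l R Rf"
  shows "approximates l (\<lambda>(x, y, z). (y + P (x, y, z)) * eval_jet l (deriv_x H) (x, y, z) +
      Q (x, y, z) * eval_jet l (deriv_y H) (x, y, z) +
      (- lam * z + R (x, y, z)) * eval_jet l (deriv_z H) (x, y, z)) (lie_derivative lam Pf Qf Rf H)"
proof -
  note v = approximates_var[OF assms(1), unfolded case_prod_unfold]
  have "approximates l (\<lambda>v. (fst (snd v) + P v) * eval_jet l (deriv_x H) v +
      Q v * eval_jet l (deriv_y H) v +
      (- lam * snd (snd v) + R v) * eval_jet l (deriv_z H) v) (lie_derivative lam Pf Qf Rf H)"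
    unfolding lie_derivative_def
    by (intro approximates_add approximates_mult approximates_eval_jet v approximates_const3 assms)
  then show ?thesis by (simp add: case_prod_unfold)
qed

text \<open>A time shift makes the orbit start at \<open>p\<close>. It avoids the origin because
  \<open>inside C\<close> is disjoint from \<open>C\<close>.\<close>

lemma center_at_origin_orbits:
  assumes "center_at_origin D Y"
  obtains V where "open V" "0 \<in> V" "\<And>p. p \<in> V \<Longrightarrow> p \<noteq> 0 \<Longrightarrow> \<exists>\<gamma> T. T > 0 \<and> \<gamma> 0 = p \<and>
      (\<forall>t. (\<gamma> has_vector_derivative Y (\<gamma> t)) (at t) \<and> \<gamma> (t + T) = \<gamma> t \<and> \<gamma> t \<noteq> 0)"
proof -
  obtain V where V: "open V" "0 \<in> V"
    "\<And>p. p \<in> V \<Longrightarrow> p \<noteq> 0 \<Longrightarrow> \<exists>C. periodic_orbit D Y C \<and> p \<in> C \<and> 0 \<in> inside C"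
    using assms unfolding center_at_origin_def zero_prod_def[symmetric] by auto
  show thesis
  proof (rule that[OF V(1,2)])
    fix p assume "p \<in> V" "p \<noteq> 0"
    then obtain C where C: "periodic_orbit D Y C" "p \<in> C" "0 \<in> inside C" using V(3) by blast
    then have "0 \<notin> C" using inside_no_overlap[of C] by blast
    obtain \<gamma> T where \<gamma>: "T > 0" "C = range \<gamma>"
      "\<And>t. (\<gamma> has_vector_derivative Y (\<gamma> t)) (at t)" "\<And>t. \<gamma> (t + T) = \<gamma> t"
      using C(1) unfolding periodic_orbit_def by blast
    obtain t0 where t0: "\<gamma> t0 = p" using C(2) \<gamma>(2) by auto
    have "((\<lambda>t. \<gamma> (t0 + t)) has_vector_derivative Y (\<gamma> (t0 + t))) (at t)" for t
    proof -
      have "((\<lambda>t. t0 + t) has_vector_derivative 1) (at t)"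
        by (auto intro!: derivative_eq_intros simp: has_vector_derivative_def)
      from vector_diff_chain_at[OF this \<gamma>(3)] show ?thesis by (simp add: o_def)
    qed
    moreover have "\<gamma> (t0 + (t + T)) = \<gamma> (t0 + t)" for t
      using \<gamma>(4)[of "t0 + t"] by (simp add: add.assoc)
    moreover have "\<gamma> (t0 + t) \<noteq> 0" for t using \<open>0 \<notin> C\<close> \<gamma>(2) by auto
    ultimately show "\<exists>\<gamma> T. T > 0 \<and> \<gamma> 0 = p \<and>
      (\<forall>t. (\<gamma> has_vector_derivative Y (\<gamma> t)) (at t) \<and> \<gamma> (t + T) = \<gamma> t \<and> \<gamma> t \<noteq> 0)"
      using \<gamma>(1) t0 by (intro exI[of _ "\<lambda>t. \<gamma> (t0 + t)"] exI[of _ T]) simp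
  qed
qed


text \<open>The leading form is at least \<open>c / 4 ^ n\<close> times
  \<open>norm p ^ (2 * n)\<close>, which beats the error as soon as
  \<open>K * norm p < c / 4 ^ n\<close>. The factors 2 in the choice of \<open>r\<close> make the
  inequalities strict.\<close>

lemma definite_near_origin:
  fixes g :: "real \<times> real \<Rightarrow> real"
  assumes "(\<lambda>p. g p - c * (fst p ^ (2 * n) + snd p ^ (2 * n))) \<in> O[nhds 0](\<lambda>p. norm p ^ Suc (2 * n))"
    and "c > 0"
  obtains r where "r > 0" "\<And>p. norm p \<le> r \<Longrightarrow> p \<noteq> 0 \<Longrightarrow> g p > 0"
proof -
  obtain K where K: "K > 0" "\<forall>\<^sub>F p in nhds 0. norm (g p - c * (fst p ^ (2 * n) + snd p ^ (2 * n)))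
      \<le> K * norm (norm p ^ Suc (2 * n))"
    using assms(1) by (rule landau_o.bigE)
  then obtain e where e: "e > 0" "\<And>p. norm p < e \<Longrightarrow>
      \<bar>g p - c * (fst p ^ (2 * n) + snd p ^ (2 * n))\<bar> \<le> K * norm p ^ Suc (2 * n)"
    by (auto simp: eventually_nhds_metric)
  define r where "r = min (e / 2) (c / (2 * K * 4 ^ n))"
  have r: "r > 0" "r < e" "r \<le> c / (2 * K * 4 ^ n)" using e(1) K(1) assms(2) by (auto simp: r_def)
  show thesis
  proof (rule that[OF r(1)])
    fix p :: "real \<times> real" assume p: "norm p \<le> r" "p \<noteq> 0"
    let ?N = "norm p ^ (2 * n)"
    have "norm p \<le> c / (2 * K * 4 ^ n)" using p(1) r(3) by simp
    then have "K * norm p \<le> c / 4 ^ n / 2" using K(1) by (simp add: field_simps)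
    also have "\<dots> < c / 4 ^ n" using divide_pos_pos[OF assms(2), of "4 ^ n"] by simp
    finally have "K * norm p * ?N < c / 4 ^ n * ?N"
      using p(2) by (intro mult_strict_right_mono) auto
    also have "\<dots> \<le> c * (fst p ^ (2 * n) + snd p ^ (2 * n))"
      using mult_left_mono[OF norm_power_le_sum_powers[of "fst p" "snd p" n], of c] assms(2)
      by (simp add: field_simps)
    finally show "g p > 0" using e(2)[of p] p(1) r(2) by (simp add: mult_ac abs_le_iff)
  qed
qed

section \<open>The Lyapunov function\<close>

definition lyapunov :: "real \<Rightarrow> nat \<Rightarrow> fps3 \<Rightarrow> real \<times> real \<times> real \<Rightarrow> real" where
  "lyapunov c n H = (\<lambda>v. c * (eval_jet (Suc (2 * n)) H v + c * (fst v * fst (snd v) ^ (2 * n - 1))))"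

definition lyapunov_deriv ::
  "real \<Rightarrow> nat \<Rightarrow> fps3 \<Rightarrow> real \<times> real \<times> real \<Rightarrow> real \<times> real \<times> real \<Rightarrow> real" where
  "lyapunov_deriv c n H v = (\<lambda>(a, b, d). c * (eval_jet (2 * n) (deriv_x H) v * a +
     eval_jet (2 * n) (deriv_y H) v * b + eval_jet (2 * n) (deriv_z H) v * d +
     c * (fst (snd v) ^ (2 * n - 1) * a + real (2 * n - 1) * fst v * fst (snd v) ^ (2 * n - 2) * b)))"

lemma has_derivative_lyapunov:
  "(lyapunov c n H has_derivative lyapunov_deriv c n H v) (at v)"
  unfolding lyapunov_def
  by (rule has_derivative_eq_rhs, (rule derivative_eq_intros has_derivative_eval_jet refl)+)
    (simp add: lyapunov_deriv_def fun_eq_iff case_prod_unfold diff_diff_left algebra_simps numeral_2_eq_2)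

lemma lyapunov_deriv_bigo:
  assumes "n > 0"
    and P: "approximates (2 * n) P Pf" and Q: "approximates (2 * n) Q Qf"
    and R: "approximates (2 * n) R Rf"
    and P2: "P \<in> O[nhds 0](\<lambda>v. norm v ^ 2)" and Q2: "Q \<in> O[nhds 0](\<lambda>v. norm v ^ 2)"
    and jet: "jet (2 * n) (lie_derivative lam Pf Qf Rf H) = const3 c * var_x ^ (2 * n)"
  shows "(\<lambda>v. lyapunov_deriv c n H v (vector_field lam P Q R v) -
      c\<^sup>2 * (fst v ^ (2 * n) + fst (snd v) ^ (2 * n))) \<in> O[nhds 0](\<lambda>v. norm v ^ Suc (2 * n))"
proof -
  define E where "E v = (fst (snd v) + P v) * eval_jet (2 * n) (deriv_x H) v +
      Q v * eval_jet (2 * n) (deriv_y H) v +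
      (- lam * snd (snd v) + R v) * eval_jet (2 * n) (deriv_z H) v - c * fst v ^ (2 * n)" for v
  \<comment> \<open>\<open>eval_jet_cong\<close> compares jets with jets; idempotence of
    \<open>jet\<close> brings the hypothesis into that form.\<close>
  have "jet (2 * n) (lie_derivative lam Pf Qf Rf H) = jet (2 * n) (const3 c * var_x ^ (2 * n))"
  proof -
    have "jet l (jet l F) = jet l F" for l F
      by (simp add: jet_def coeff3_def fps_eq_iff)
    then show ?thesis by (metis jet)
  qed
  then have "eval_jet (2 * n) (lie_derivative lam Pf Qf Rf H) v = c * fst v ^ (2 * n)" for v
    by (subst eval_jet_cong)
      (auto simp: eval_jet_single[OF coeff_at_const3_var_x_power] degree3_def monom3_def case_prod_unfold)
  moreover have "2 * n > 0" using assms(1) by simp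
  ultimately have E: "E \<in> O[nhds 0](\<lambda>v. norm v ^ Suc (2 * n))"
    using approximates_lie_derivative[OF _ P Q R, where lam = lam and H = H]
    by (simp add: approximates_def case_prod_unfold E_def[abs_def])
  have e: "norm v ^ 2 * norm v ^ (2 * n - 1) = norm v ^ Suc (2 * n)" for v :: "real \<times> real \<times> real"
    using assms(1) by (simp flip: power_add)
  have "(\<lambda>v. P v * monom3 (0, 2 * n - 1, 0) v) \<in> O[nhds 0](\<lambda>v. norm v ^ 2 * norm v ^ (2 * n - 1))"
    by (intro landau_o.big.mult P2 monom3_bigo) (simp add: degree3_def)
  moreover have "(\<lambda>v. Q v * monom3 (1, 2 * n - 2, 0) v) \<in> O[nhds 0](\<lambda>v. norm v ^ 2 * norm v ^ (2 * n - 1))"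
    using assms(1) by (intro landau_o.big.mult Q2 monom3_bigo) (simp add: degree3_def)
  ultimately have "(\<lambda>v. c * E v + c\<^sup>2 * (P v * monom3 (0, 2 * n - 1, 0) v) +
      c\<^sup>2 * real (2 * n - 1) * (Q v * monom3 (1, 2 * n - 2, 0) v)) \<in> O[nhds 0](\<lambda>v. norm v ^ Suc (2 * n))"
    unfolding e using E by (intro sum_in_bigo(1)) simp_all
  moreover have "c * E v + c\<^sup>2 * (P v * monom3 (0, 2 * n - 1, 0) v) +
      c\<^sup>2 * real (2 * n - 1) * (Q v * monom3 (1, 2 * n - 2, 0) v) =
      lyapunov_deriv c n H v (vector_field lam P Q R v) - c\<^sup>2 * (fst v ^ (2 * n) + fst (snd v) ^ (2 * n))" for v
  proof -
    obtain x y z where v: "v = (x, y, z)" by (cases v)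
    have "y ^ (2 * n) = y * y ^ (2 * n - 1)" using assms(1) by (simp flip: power_Suc)
    then show ?thesis
      by (simp add: v E_def lyapunov_deriv_def vector_field_def monom3_def algebra_simps power2_eq_square)
  qed
  ultimately show ?thesis by simp
qed

section \<open>Monotonicity on the center manifold against the periodic orbits of a center\<close>

theorem theorem30:
  fixes lam :: real
    and U :: "(real \<times> real \<times> real) set"
    and P Q R :: "real \<times> real \<times> real \<Rightarrow> real"
    and Pf Qf Rf H :: fps3
    and \<omega> :: "nat \<Rightarrow> real"
    and n :: nat
  assumes "lam \<noteq> 0"
    and "open U" and "(0, 0, 0) \<in> U"
    and "real_analytic_on P U" and "real_analytic_on Q U" and "real_analytic_on R U"
    and "has_power_series_at P Pf (0, 0, 0)"
    and "has_power_series_at Q Qf (0, 0, 0)"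
    and "has_power_series_at R Rf (0, 0, 0)"
    and "jet 1 Pf = 0" and "jet 1 Qf = 0" and "jet 1 Rf = 0"
    and "jet 2 H = var_y ^ 2"
    and "lie_derivative lam Pf Qf Rf H = series_in_x (\<lambda>k. if k \<ge> 4 then \<omega> k else 0)"
    and "jet (2 * n) (lie_derivative lam Pf Qf Rf H) = const3 (\<omega> (2 * n)) * var_x ^ (2 * n)"
    and "\<omega> (2 * n) \<noteq> 0"
  shows "\<exists>r. \<forall>D h. center_manifold r U (vector_field lam P Q R) D h \<longrightarrow>
           \<not> center_at_origin D (reduced_field P Q h)"
proof (intro exI[of _ 1] allI impI notI)
  fix D h
  assume cm: "center_manifold 1 U (vector_field lam P Q R) D h"
    and center: "center_at_origin D (reduced_field P Q h)"
  define c where "c = \<omega> (2 * n)"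
  let ?Y = "reduced_field P Q h"
  \<comment> \<open>For \<open>n = 0\<close> the jet hypothesis would make \<open>\<omega> 0\<close>
    the constant term of \<open>XH\<close>, which vanishes because the series starts at degree
    4.\<close>
  have "n > 0"
  proof (rule ccontr)
    assume "\<not> n > 0"
    have "coeff_at (jet (2 * n) (lie_derivative lam Pf Qf Rf H)) (2 * n, 0, 0) = \<omega> (2 * n)"
      unfolding assms(15) by (simp add: coeff_at_const3_var_x_power)
    then show False
      using assms(16) \<open>\<not> n > 0\<close>
      by (simp add: assms(14) jet_def coeff_at_def coeff3_def series_in_x_def)
  qed
  have D: "open D" "(0, 0) \<in> D" "class_C 1 D h" "h 0 = 0"
    "locally_invariant (vector_field lam P Q R) (graph_over D h)"
    using cm by (auto simp: center_manifold_def zero_prod_def)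
  note series = assms(7-9)[THEN has_power_series_at_approximates]
  have P2: "P \<in> O[nhds 0](\<lambda>v. norm v ^ 2)" and Q2: "Q \<in> O[nhds 0](\<lambda>v. norm v ^ 2)"
    using approximates_0_bigo series(1,2) assms(10,11) by blast+
  \<comment> \<open>A property that holds eventually in \<open>nhds 0\<close> holds at 0, where the
    bound is 0.\<close>
  have at_0: "f 0 = 0" if "f \<in> O[nhds 0](\<lambda>v. norm v ^ 2)" for f :: "real \<times> real \<times> real \<Rightarrow> real"
    using landau_o.bigE[OF that] by (metis (no_types, lifting) eventually_nhds_x_imp_x norm_zero
        zero_power2 norm_le_zero_iff mult_zero_right)
  obtain s1 K1 where P: "s1 > 0" "K1-lipschitz_on (cball 0 s1) P"
    using has_power_series_at_lipschitz[OF assms(7)] by metis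
  obtain s2 K2 where Q: "s2 > 0" "K2-lipschitz_on (cball 0 s2) Q"
    using has_power_series_at_lipschitz[OF assms(8)] by metis
  obtain s K where h: "s > 0" "cball 0 s \<subseteq> D" "K-lipschitz_on (cball 0 s) h"
    using class_C_1_lipschitz[OF D(3,1,2)] by (metis zero_prod_def)
  obtain t L where Y: "t > 0" "L-lipschitz_on (cball 0 t) ?Y"
    using lipschitz_reduced_field[OF P(2,1) Q(2,1) h(3,1) D(4)] by metis
  obtain V where V: "open V" "0 \<in> V" "\<And>p. p \<in> V \<Longrightarrow> p \<noteq> 0 \<Longrightarrow> \<exists>\<gamma> T. T > 0 \<and> \<gamma> 0 = p \<and>
      (\<forall>t. (\<gamma> has_vector_derivative ?Y (\<gamma> t)) (at t) \<and> \<gamma> (t + T) = \<gamma> t \<and> \<gamma> t \<noteq> 0)"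
    using center_at_origin_orbits[OF center] by metis
  obtain e where e: "e > 0" "cball 0 e \<subseteq> V" using V(1,2) open_contains_cball by blast
  have hK: "\<bar>h p\<bar> \<le> K * norm p" if "norm p \<le> s" for p
    using lipschitz_on_normD[OF h(3), of p 0] that h(1) D(4) by simp
  have norm_lift: "norm (lift_to_graph h p) \<le> (2 + K) * norm p" if "norm p \<le> s" for p
    by (intro norm_lift_to_graph_le hK that)
  have small: "\<forall>\<^sub>F p in nhds (0::real \<times> real). norm p \<le> s"
    using h(1) by (auto simp: eventually_nhds_metric intro!: exI[of _ s])
  have lift_0: "filterlim (lift_to_graph h) (nhds 0) (nhds 0)"
  proof -
    have "((\<lambda>p::real \<times> real. (2 + K) * norm p) \<longlongrightarrow> (2 + K) * norm (0::real \<times> real)) (nhds 0)"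
      by (intro tendsto_mult tendsto_const tendsto_norm filterlim_ident)
    then have "((\<lambda>p. (2 + K) * norm p) \<longlongrightarrow> 0) (nhds (0::real \<times> real))" by simp
    moreover have "\<forall>\<^sub>F p in nhds 0. norm (lift_to_graph h p) \<le> (2 + K) * norm p"
      using small by (rule eventually_mono) (rule norm_lift)
    ultimately show ?thesis by (rule Lim_null_comparison[rotated])
  qed
  define g where "g p = lyapunov_deriv c n H (lift_to_graph h p) (vector_field lam P Q R (lift_to_graph h p))" for p
  have "(\<lambda>p. g p - c\<^sup>2 * (fst p ^ (2 * n) + snd p ^ (2 * n))) \<in> O[nhds 0](\<lambda>p. norm (lift_to_graph h p) ^ Suc (2 * n))"
    using landau_o.big.compose[OF lyapunov_deriv_bigo[OF \<open>n > 0\<close> series P2 Q2 assms(15)] lift_0]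
    by (simp add: g_def c_def lift_to_graph_def case_prod_unfold)
  \<comment> \<open>The lift is Lipschitz at the origin, so the error keeps its order in the planar
    variables.\<close>
  also have "(\<lambda>p. norm (lift_to_graph h p) ^ Suc (2 * n)) \<in> O[nhds 0](\<lambda>p. norm p ^ Suc (2 * n))"
  proof (rule landau_o.big_power)
    have "\<forall>\<^sub>F p in nhds 0. norm (norm (lift_to_graph h p)) \<le> (2 + K) * norm (norm p)"
      using small by (rule eventually_mono) (simp add: norm_lift)
    then show "(\<lambda>p. norm (lift_to_graph h p)) \<in> O[nhds 0](norm)" by (rule bigoI)
  qed
  finally obtain r where r: "r > 0" "\<And>p. norm p \<le> r \<Longrightarrow> p \<noteq> 0 \<Longrightarrow> g p > 0"
    using definite_near_origin[of g "c\<^sup>2" n] assms(16) by (auto simp: c_def)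
  obtain fx fy where h': "\<And>q. q \<in> D \<Longrightarrow> (h has_derivative (\<lambda>(u, v). fx q * u + fy q * v)) (at q)"
    using D(3) by auto
  define W' where "W' p w = lyapunov_deriv c n H (lift_to_graph h p)
    (fst w, snd w, fx p * fst w + fy p * snd w)" for p w
  \<comment> \<open>Within radius \<open>s\<close> the point lies in \<open>D\<close>, within
    \<open>t\<close> the planar field is Lipschitz, within \<open>e\<close> the orbits are periodic,
    and within \<open>r\<close> the derivative \<open>g\<close> is positive off the origin.\<close>
  define d where "d = min (min s t) (min e r)"
  show False
  proof (rule no_periodic_orbits_near_equilibrium[where W = "\<lambda>p. lyapunov c n H (lift_to_graph h p)" and W' = W'])
    show "d > 0" using h(1) Y(1) e(1) r(1) by (simp add: d_def)
    \<comment> \<open>A Lipschitz constant may be 0, whereas a positive one is required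
      here.\<close>
    show "max L 1 > 0" by simp
    show "(max L 1)-lipschitz_on (cball 0 d) ?Y"
      by (rule lipschitz_on_mono[OF Y(2)]) (auto simp: d_def)
    show "?Y 0 = 0"
      using at_0[OF P2] at_0[OF Q2] D(4) by (simp add: reduced_field_def zero_prod_def)
    fix p :: "real \<times> real" assume p: "p \<in> cball 0 d" "p \<noteq> 0"
    have "p \<in> D" using p h(2) by (auto simp: d_def)
    note hp = h'[OF this]
    have "lift_to_graph h = (\<lambda>p. (fst p, snd p, h p))" by (auto simp: lift_to_graph_def)
    then have "(lift_to_graph h has_derivative (\<lambda>w. (fst w, snd w, fx p * fst w + fy p * snd w))) (at p)"
      using hp by (auto intro!: derivative_eq_intros simp: case_prod_unfold)
    from has_derivative_compose[OF this has_derivative_lyapunov]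
    show "((\<lambda>p. lyapunov c n H (lift_to_graph h p)) has_derivative W' p) (at p)"
      by (simp add: W'_def[abs_def])
    obtain x y where xy: "p = (x, y)" by (cases p)
    \<comment> \<open>By the invariance equation the third component of the lifted planar velocity
      is that of the field in space, so the planar and the spatial derivative of the Lyapunov
      function agree on the surface.\<close>
    have "W' p (?Y p) = g p"
      using locally_invariant_graph_derivative[OF D(5), of x y] hp \<open>p \<in> D\<close>
      by (simp add: xy W'_def g_def lift_to_graph_def vector_field_def reduced_field_def)
    then show "W' p (?Y p) > 0" using r(2)[of p] p by (simp add: d_def)
    show "\<exists>\<gamma> T. T > 0 \<and> \<gamma> 0 = p \<and>
      (\<forall>t. (\<gamma> has_vector_derivative ?Y (\<gamma> t)) (at t) \<and> \<gamma> (t + T) = \<gamma> t \<and> \<gamma> t \<noteq> 0)"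
      using V(3)[of p] e(2) p by (auto simp: d_def)
  qed
qed

end
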